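(* Let $z_C$ and $z_R$ denote the optimal values of the problems SDP-C and SDP-R, respectively, built from the same ACOPF instance (both problems are defined in the context). Then $z_C \le z_R$.
   Context: **Instance data.** A power network consists of a finite set $\mathcal{B}=\{1,\dots,n\}$ of buses, a finite set $\mathcal{E}$ of branches $\{k,m\}$ with $k\neq m$ in $\mathcal{B}$, and a finite set $\mathcal{G}$ of generators; for each bus $k$, $\mathcal{G}_k\subseteq\mathcal{G}$ is the set of generators at $k$, and $\delta(k)$ is the set of branches incident to $k$. Each branch $\{k,m\}$ is written with a fixed orientation, i.e. a fixed ordered representation $(k,m)$. For each bus $k$ we are given reals $P^d_k,Q^d_k$ (loads) and voltage limits $\underline{V}_k,\overline{V}_k\ge 0$. For each branch $\{k,m\}$ we are given real parameters $G_{kk},B_{kk},G_{km},B_{km},G_{mk},B_{mk},G_{mm},B_{mm}$ (depending on the branch) and a limit $0\le U_{km}\le+\infty$. For each generator $k\in\mathcal{G}$ we are given real bounds $\underline{P}^g_k,\overline{P}^g_k,\underline{Q}^g_k,\overline{Q}^g_k$ and a cost function $F_k:\mathbb{R}\to\mathbb{R}$. **Common real variables.** $P^g_k,Q^g_k$ ($k\in\mathcal{G}$); $v^{(2)}_k$ ($k\in\mathcal{B}$); $P_{km},P_{mk},Q_{km},Q_{mk},c_{km},s_{km}$ ($\{k,m\}\in\mathcal{E}$, with oriented representation $(k,m)$). **Common constraints.** - For all $k\in\mathcal{B}$: $\underline{V}_k^2\le v_k^{(2)}\le\overline{V}_k^2$, $\ \sum_{\{k,m\}\in\delta(k)}P_{km}=\sum_{\ell\in\mathcal{G}_k}P^g_\ell-P^d_k$,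 $\ \sum_{\{k,m\}\in\delta(k)}Q_{km}=\sum_{\ell\in\mathcal{G}_k}Q^g_\ell-Q^d_k$. (In these sums $P_{km},Q_{km}$ denote the flow variables at the $k$-end of the branch $\{k,m\}$, whichever the orientation.) - For all $\{k,m\}\in\mathcal{E}$ (oriented as $(k,m)$): $P_{km}=G_{kk}v_k^{(2)}+G_{km}c_{km}+B_{km}s_{km}$, $P_{mk}=G_{mm}v_m^{(2)}+G_{mk}c_{km}-B_{mk}s_{km}$, $Q_{km}=-B_{kk}v_k^{(2)}-B_{km}c_{km}+G_{km}s_{km}$, $Q_{mk}=-B_{mm}v_m^{(2)}-B_{mk}c_{km}-G_{mk}s_{km}$, $\max\{P_{km}^2+Q_{km}^2,\;P_{mk}^2+Q_{mk}^2\}\le U_{km}^2$. - For all $k\in\mathcal{G}$: $\underline{P}^g_k\le P^g_k\le\overline{P}^g_k$ and $\underline{Q}^g_k\le Q^g_k\le\overline{Q}^g_k$. **SDP-C.** Minimize $\sum_{k\in\mathcal{G}}F_k(P^g_k)$ over the common variables and a Hermitian matrix $X\in\mathbb{C}^{n\times n}$, subject to the common constraints and: $v_k^{(2)}=X_{kk}$ for all $k\in\mathcal{B}$; $c_{km}=\frac{X_{km}+X_{mk}}{2}$ and $s_{km}=\frac{X_{km}-X_{mk}}{2j}$ for all $\{k,m\}\in\mathcal{E}$, where $j$ is the imaginary unit; and $X\succeq 0$ (positive semidefinite over $\mathbb{C}$). **SDP-R.** Minimize $\sum_{k\in\mathcal{G}}F_k(P^g_k)$ over the common variables and a symmetric matrix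 $W\in\mathbb{R}^{2n\times 2n}$, subject to the common constraints and: $v_k^{(2)}=W_{kk}+W_{k'k'}$ for all $k\in\mathcal{B}$; $c_{km}=W_{km}+W_{k'm'}$ and $s_{km}=W_{mk'}-W_{km'}$ for all $\{k,m\}\in\mathcal{E}$; and $W\succeq 0$. Here, for $k\in\{1,\dots,n\}$, $k':=n+k$. The optimal value of a problem is the infimum of its objective over its feasible set, with value $+\infty$ if the feasible set is empty. *)

theory Defs
  imports "Jordan_Normal_Form.Schur_Decomposition" "HOL-Library.Extended_Real"
begin

text \<open>
  Buses are numbered \<open>0, \<dots>, n - 1\<close>, matching the 0-based indices of matrices; the bus \<open>k\<close> has
  the companion index \<open>k' = n + k\<close> in the real \<open>2n \<times> 2n\<close> matrix.  A branch \<open>{k, m}\<close> is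
  represented by its fixed orientation, an ordered pair \<open>(k, m)\<close>.  Functions with two bus
  arguments that describe a branch are relevant only at its oriented pair.
\<close>

record 'g acopf =
  num_buses :: nat
  branches :: "(nat \<times> nat) set"
  gens :: "'g set"
  gens_at :: "nat \<Rightarrow> 'g set"
  P_load :: "nat \<Rightarrow> real"
  Q_load :: "nat \<Rightarrow> real"
  V_min :: "nat \<Rightarrow> real"
  V_max :: "nat \<Rightarrow> real"
  G_kk :: "nat \<Rightarrow> nat \<Rightarrow> real"
  B_kk :: "nat \<Rightarrow> nat \<Rightarrow> real"
  G_km :: "nat \<Rightarrow> nat \<Rightarrow> real"
  B_km :: "nat \<Rightarrow> nat \<Rightarrow> real"
  G_mk :: "nat \<Rightarrow> nat \<Rightarrow> real"
  B_mk :: "nat \<Rightarrow> nat \<Rightarrow> real"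
  G_mm :: "nat \<Rightarrow> nat \<Rightarrow> real"
  B_mm :: "nat \<Rightarrow> nat \<Rightarrow> real"
  U_max :: "nat \<Rightarrow> nat \<Rightarrow> ereal"
  Pg_min :: "'g \<Rightarrow> real"
  Pg_max :: "'g \<Rightarrow> real"
  Qg_min :: "'g \<Rightarrow> real"
  Qg_max :: "'g \<Rightarrow> real"
  cost :: "'g \<Rightarrow> real \<Rightarrow> real"

definition acopf_instance :: "'g acopf \<Rightarrow> bool" where
  "acopf_instance N \<longleftrightarrow>
     branches N \<subseteq> {..<num_buses N} \<times> {..<num_buses N} \<and>
     (\<forall>(k, m) \<in> branches N. k \<noteq> m \<and> (m, k) \<notin> branches N \<and> 0 \<le> U_max N k m) \<and>
     finite (gens N) \<and>
     (\<forall>k < num_buses N. gens_at N k \<subseteq> gens N \<and> 0 \<le> V_min N k \<and> 0 \<le> V_max N k)"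

definition neighbours :: "'g acopf \<Rightarrow> nat \<Rightarrow> nat set" where
  "neighbours N k = {m. (k, m) \<in> branches N \<or> (m, k) \<in> branches N}"

text \<open>
  \<open>P_flow x k m\<close> and \<open>Q_flow x k m\<close> are the flows at the \<open>k\<close>-end of the branch \<open>{k, m}\<close>, used for
  both orders of the arguments; \<open>c_var\<close> and \<open>s_var\<close> are used only at oriented pairs.
\<close>

record 'g acopf_vars =
  P_gen :: "'g \<Rightarrow> real"
  Q_gen :: "'g \<Rightarrow> real"
  v2_var :: "nat \<Rightarrow> real"
  P_flow :: "nat \<Rightarrow> nat \<Rightarrow> real"
  Q_flow :: "nat \<Rightarrow> nat \<Rightarrow> real"
  c_var :: "nat \<Rightarrow> nat \<Rightarrow> real"
  s_var :: "nat \<Rightarrow> nat \<Rightarrow> real"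

definition bus_constraints :: "'g acopf \<Rightarrow> 'g acopf_vars \<Rightarrow> bool" where
  "bus_constraints N x \<longleftrightarrow>
     (\<forall>k < num_buses N.
        (V_min N k)\<^sup>2 \<le> v2_var x k \<and> v2_var x k \<le> (V_max N k)\<^sup>2 \<and>
        (\<Sum>m \<in> neighbours N k. P_flow x k m) = (\<Sum>l \<in> gens_at N k. P_gen x l) - P_load N k \<and>
        (\<Sum>m \<in> neighbours N k. Q_flow x k m) = (\<Sum>l \<in> gens_at N k. Q_gen x l) - Q_load N k)"

definition branch_constraints :: "'g acopf \<Rightarrow> 'g acopf_vars \<Rightarrow> bool" where
  "branch_constraints N x \<longleftrightarrow>
     (\<forall>(k, m) \<in> branches N.
        P_flow x k m = G_kk N k m * v2_var x k + G_km N k m * c_var x k m + B_km N k m * s_var x k m \<and>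
        P_flow x m k = G_mm N k m * v2_var x m + G_mk N k m * c_var x k m - B_mk N k m * s_var x k m \<and>
        Q_flow x k m = - B_kk N k m * v2_var x k - B_km N k m * c_var x k m + G_km N k m * s_var x k m \<and>
        Q_flow x m k = - B_mm N k m * v2_var x m - B_mk N k m * c_var x k m - G_mk N k m * s_var x k m \<and>
        ereal (max ((P_flow x k m)\<^sup>2 + (Q_flow x k m)\<^sup>2) ((P_flow x m k)\<^sup>2 + (Q_flow x m k)\<^sup>2))
          \<le> (U_max N k m)\<^sup>2)"

definition generator_constraints :: "'g acopf \<Rightarrow> 'g acopf_vars \<Rightarrow> bool" where
  "generator_constraints N x \<longleftrightarrow>
     (\<forall>l \<in> gens N.
        Pg_min N l \<le> P_gen x l \<and> P_gen x l \<le> Pg_max N l \<and>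
        Qg_min N l \<le> Q_gen x l \<and> Q_gen x l \<le> Qg_max N l)"

definition common_constraints :: "'g acopf \<Rightarrow> 'g acopf_vars \<Rightarrow> bool" where
  "common_constraints N x \<longleftrightarrow>
     bus_constraints N x \<and> branch_constraints N x \<and> generator_constraints N x"

definition total_cost :: "'g acopf \<Rightarrow> 'g acopf_vars \<Rightarrow> real" where
  "total_cost N x = (\<Sum>l \<in> gens N. cost N l (P_gen x l))"

text \<open>
  Over the reals conjugation is the identity, so this covers both the real and the complex case.
  For complex \<open>z\<close>, \<open>0 \<le> z\<close> says that \<open>z\<close> is real and nonnegative.
\<close>

definition psd_mat :: "nat \<Rightarrow> 'a :: conjugatable_ordered_field mat \<Rightarrow> bool" where
  "psd_mat d A \<longleftrightarrow>
     A \<in> carrier_mat d d \<and> mat_adjoint A = A \<and>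
     (\<forall>v \<in> carrier_vec d. 0 \<le> (A *\<^sub>v v) \<bullet>c v)"

definition feasible_C :: "'g acopf \<Rightarrow> 'g acopf_vars \<Rightarrow> complex mat \<Rightarrow> bool" where
  "feasible_C N x X \<longleftrightarrow>
     common_constraints N x \<and>
     X \<in> carrier_mat (num_buses N) (num_buses N) \<and> mat_adjoint X = X \<and>
     (\<forall>k < num_buses N. of_real (v2_var x k) = X $$ (k, k)) \<and>
     (\<forall>(k, m) \<in> branches N.
        of_real (c_var x k m) = (X $$ (k, m) + X $$ (m, k)) / 2 \<and>
        of_real (s_var x k m) = (X $$ (k, m) - X $$ (m, k)) / (2 * \<i>)) \<and>
     psd_mat (num_buses N) X"

definition feasible_R :: "'g acopf \<Rightarrow> 'g acopf_vars \<Rightarrow> real mat \<Rightarrow> bool" where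
  "feasible_R N x W \<longleftrightarrow>
     (let n = num_buses N in
       common_constraints N x \<and>
       W \<in> carrier_mat (2 * n) (2 * n) \<and> transpose_mat W = W \<and>
       (\<forall>k < n. v2_var x k = W $$ (k, k) + W $$ (n + k, n + k)) \<and>
       (\<forall>(k, m) \<in> branches N.
          c_var x k m = W $$ (k, m) + W $$ (n + k, n + m) \<and>
          s_var x k m = W $$ (m, n + k) - W $$ (k, n + m)) \<and>
       psd_mat (2 * n) W)"

text \<open>The infimum of the empty set in \<^typ>\<open>ereal\<close> is \<open>\<infinity>\<close>.\<close>

definition z_C :: "'g acopf \<Rightarrow> ereal" where
  "z_C N = Inf {ereal (total_cost N x) | x X. feasible_C N x X}"

definition z_R :: "'g acopf \<Rightarrow> ereal" where
  "z_R N = Inf {ereal (total_cost N x) | x W. feasible_R N x W}"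

end

theory Submission
  imports Defs
begin

text \<open>
  With \<open>M\<close> the \<open>2n \<times> n\<close> block matrix with blocks \<open>I\<close> and \<open>-\<i> I\<close>, every feasible \<open>W\<close> of SDP-R gives
  the feasible \<open>X = M\<^sup>* W M\<close> of SDP-C, with the same common variables and so the same cost.  For
  \<open>z = a + \<i> b\<close> one has \<open>M z = u + \<i> v\<close> with the real vectors \<open>u = (a, b)\<close> and \<open>v = (b, -a)\<close>, and
  hence \<open>z\<^sup>* X z = u\<^sup>T W u + v\<^sup>T W v \<ge> 0\<close>.
\<close>

lemma quadratic_form_eq_sum:
  assumes "A \<in> carrier_mat d d" "v \<in> carrier_vec d"
  shows "(A *\<^sub>v v) \<bullet>c v = (\<Sum>i<d. \<Sum>j<d. A $$ (i, j) * v $ j * conjugate (v $ i))"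
  using assms
  by (auto simp: scalar_prod_def sum_distrib_right atLeast0LessThan intro!: sum.cong)

lemma sum_lessThan_double:
  "(\<Sum>i<2 * n. f i) = (\<Sum>i<n. f i + f (n + i))" for f :: "nat \<Rightarrow> 'a :: comm_monoid_add"
  using sum.atLeastLessThan_concat[of 0 n "2 * n" f] sum.shift_bounds_nat_ivl[of f 0 n n]
  by (simp add: sum.distrib atLeast0LessThan mult_2 add.commute)

text \<open>Exchanging the two indices turns the sum into its own negative. This removes the
  imaginary part of the quadratic form in \<open>compress_psd\<close>.\<close>

lemma sum_antisymmetric_eq_0:
  fixes h :: "'b \<Rightarrow> 'b \<Rightarrow> real"
  assumes "\<And>i j. i \<in> I \<Longrightarrow> j \<in> I \<Longrightarrow> h j i = - h i j"
  shows "(\<Sum>i\<in>I. \<Sum>j\<in>I. h i j) = 0"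
proof -
  have "(\<Sum>i\<in>I. \<Sum>j\<in>I. h i j) = (\<Sum>i\<in>I. \<Sum>j\<in>I. h j i)"
    by (rule sum.swap)
  also have "\<dots> = - (\<Sum>i\<in>I. \<Sum>j\<in>I. h i j)"
    unfolding sum_negf[symmetric] by (intro sum.cong refl assms)
  finally show ?thesis by simp
qed

text \<open>The product \<open>M\<^sup>* W M\<close> multiplied out: for \<open>W\<close> with
  blocks \<open>W11\<close>, \<open>W12\<close>, \<open>W21\<close>, \<open>W22\<close> it is
  \<open>W11 + W22 + \<i> (W21 - W12)\<close>.\<close>

definition compress :: "nat \<Rightarrow> real mat \<Rightarrow> complex mat" where
  "compress n W = mat n n (\<lambda>(k, m).
     Complex (W $$ (k, m) + W $$ (n + k, n + m)) (W $$ (n + k, m) - W $$ (k, n + m)))"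

lemma compress_carrier [simp]: "compress n W \<in> carrier_mat n n"
  by (simp add: compress_def)

lemma symmetric_index:
  assumes "transpose_mat W = W" "W \<in> carrier_mat d d" "i < d" "j < d"
  shows "W $$ (i, j) = W $$ (j, i)"
  using assms by (metis carrier_matD index_transpose_mat(1))

text \<open>For symmetric \<open>W\<close>, the diagonal blocks are symmetric and \<open>W21\<close>
  is the transpose of \<open>W12\<close>, so \<open>W21 - W12\<close> is antisymmetric.\<close>

lemma compress_hermitian:
  assumes W: "W \<in> carrier_mat (2 * n) (2 * n)" "transpose_mat W = W"
  shows "mat_adjoint (compress n W) = compress n W"
  by (rule eq_matI)
    (auto simp: compress_def mat_adjoint_def mat_of_rows_def complex_eq_iff
      symmetric_index[OF W(2,1)])

lemma compress_psd:
  assumes W: "transpose_mat W = W" and psd: "psd_mat (2 * n) W"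
  shows "psd_mat n (compress n W)"
proof -
  have carrier: "W \<in> carrier_mat (2 * n) (2 * n)"
    using psd by (simp add: psd_mat_def)
  have "0 \<le> (compress n W *\<^sub>v z) \<bullet>c z" if z: "z \<in> carrier_vec n" for z
  proof -
    define a where "a i = Re (z $ i)" for i
    define b where "b i = Im (z $ i)" for i
    define u where "u = vec (2 * n) (\<lambda>i. if i < n then a i else b (i - n))"
    define v where "v = vec (2 * n) (\<lambda>i. if i < n then b i else - a (i - n))"
    have uv: "u \<in> carrier_vec (2 * n)" "v \<in> carrier_vec (2 * n)"
      by (simp_all add: u_def v_def)
    have index: "u $ i = a i" "u $ (n + i) = b i" "v $ i = b i" "v $ (n + i) = - a i"
      if "i < n" for i
      using that by (simp_all add: u_def v_def)
    let ?q = "(compress n W *\<^sub>v z) \<bullet>c z"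
    let ?f = "\<lambda>i j. compress n W $$ (i, j) * z $ j * conjugate (z $ i)"
    have q: "?q = (\<Sum>i<n. \<Sum>j<n. ?f i j)"
      using z by (intro quadratic_form_eq_sum) simp_all
    \<comment> \<open>The identity holds for each pair \<open>(i, j)\<close>: the four block terms
      for \<open>u\<close> and the four for \<open>v\<close> add up to the real part of
      \<open>?f i j\<close>.\<close>
    have "Re ?q = (W *\<^sub>v u) \<bullet>c u + (W *\<^sub>v v) \<bullet>c v"
      unfolding q quadratic_form_eq_sum[OF carrier uv(1)] quadratic_form_eq_sum[OF carrier uv(2)]
        sum_lessThan_double Re_sum sum.distrib[symmetric]
      by (intro sum.cong refl)
        (simp add: index, simp add: compress_def a_def b_def algebra_simps)
    then have "0 \<le> Re ?q"
      using psd uv by (simp add: psd_mat_def)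
    \<comment> \<open>Exchanging \<open>i\<close> and \<open>j\<close> conjugates
      \<open>?f i j\<close>, because \<open>compress n W\<close> is Hermitian.\<close>
    moreover have "Im ?q = 0"
      unfolding q Im_sum
      by (rule sum_antisymmetric_eq_0)
        (simp add: compress_def symmetric_index[OF W carrier] algebra_simps)
    ultimately show ?thesis
      by (simp add: less_eq_complex_def)
  qed
  then show ?thesis
    using compress_hermitian[OF carrier W] by (simp add: psd_mat_def)
qed

text \<open>For a Hermitian \<open>X\<close> the SDP-C formulas for \<open>c\<close> and
  \<open>s\<close> give the real and imaginary parts of \<open>X $$ (k, m)\<close>; by symmetry of
  \<open>W\<close> these are the SDP-R formulas.\<close>

lemma feasible_C_compress:
  assumes N: "acopf_instance N" and R: "feasible_R N x W"
  shows "feasible_C N x (compress (num_buses N) W)"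
proof -
  let ?n = "num_buses N"
  have W: "W \<in> carrier_mat (2 * ?n) (2 * ?n)" "transpose_mat W = W" "psd_mat (2 * ?n) W"
    using R by (simp_all add: feasible_R_def Let_def)
  note sym = symmetric_index[OF W(2,1)]
  have lt: "k < ?n \<and> m < ?n" if "(k, m) \<in> branches N" for k m
    using N that by (auto simp: acopf_instance_def)
  have "of_real (c_var x k m) = (compress ?n W $$ (k, m) + compress ?n W $$ (m, k)) / 2 \<and>
      of_real (s_var x k m) = (compress ?n W $$ (k, m) - compress ?n W $$ (m, k)) / (2 * \<i>)"
    if km: "(k, m) \<in> branches N" for k m
  proof -
    have "c_var x k m = W $$ (k, m) + W $$ (?n + k, ?n + m)"
      "s_var x k m = W $$ (m, ?n + k) - W $$ (k, ?n + m)"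
      using R km by (auto simp: feasible_R_def Let_def)
    then show ?thesis
      using lt[OF km] sym[of m k] sym[of "?n + m" "?n + k"] sym[of "?n + k" m] sym[of "?n + m" k]
      by (simp add: compress_def complex_eq_iff Re_divide Im_divide power2_eq_square field_simps)
  qed
  \<comment> \<open>The diagonal entries are real since \<open>W $$ (n + k, k)\<close> and
    \<open>W $$ (k, n + k)\<close> cancel.\<close>
  moreover have "of_real (v2_var x k) = compress ?n W $$ (k, k)" if "k < ?n" for k
    using R that sym[of k "?n + k"]
    by (auto simp: feasible_R_def Let_def compress_def complex_eq_iff)
  ultimately show ?thesis
    using R compress_hermitian[OF W(1,2)] compress_psd[OF W(2,3)]
    by (auto simp: feasible_C_def feasible_R_def Let_def)
qed

theorem mainTheorem1:
  fixes N :: "'g acopf"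
  assumes "acopf_instance N"
  shows "z_C N \<le> z_R N"
  unfolding z_C_def z_R_def
  using feasible_C_compress[OF assms] by (intro Inf_superset_mono) blast

end
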